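(* Let $n\ge 1$ be an integer and let $a,b,c,\mu,\nu,\kappa\in\mathbb{R}$. Suppose $y$ is a degree $n$ polynomial, $y=c_n\prod_{i=1}^n (x-x_i)$ with $c_n,x_1,\dots,x_n\in\mathbb{R}$ and $c_n\neq 0$, that solves the differential equation $$(ax^2+bx+c)\,y''+(\mu x+\nu)\,y'+\kappa y=0.$$ If the zeros $x_1,\dots,x_n$ of $y$ are distinct, then for each integer $k\in[1,n]$, $$2\sum_{j\in J_k}\frac{ax_k^2+bx_k+c}{x_k-x_j}+\nu+\mu x_k=0,$$ where $J_k$ consists of all integers in $[1,n]$ except $k$.
   Context: Primes denote derivatives with respect to $x$. An empty sum (the case $n=1$) is $0$. *)

theory Defs
  imports Complex_Main "HOL-Computational_Algebra.Polynomial"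
begin

end

theory Submission
  imports Defs
begin

text \<open>
  Factor $y = (X - x_k)\,q$. Then $y'(x_k) = q(x_k)$ and $y''(x_k) = 2 q'(x_k)$, while
  $q'/q$ at $x_k$ is the sum of the $1/(x_k - x_j)$. Evaluating the differential
  equation at $x_k$, where $y$ vanishes, and dividing by $q(x_k) \neq 0$ gives the claim.
\<close>

text \<open>This is the logarithmic derivative of a product of linear factors, multiplied through by
  the product. Induction with the product rule then suffices.\<close>

lemma poly_pderiv_prod_linear:
  fixes x :: "'i \<Rightarrow> 'a::field"
  assumes "finite A" and "\<And>i. i \<in> A \<Longrightarrow> t \<noteq> x i"
  shows "poly (pderiv (\<Prod>i\<in>A. [:- x i, 1:])) t
    = poly (\<Prod>i\<in>A. [:- x i, 1:]) t * (\<Sum>i\<in>A. 1 / (t - x i))"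
  using assms
  by (induction A rule: finite_induct)
    (simp_all add: pderiv_mult pderiv_pCons field_simps del: mult_pCons_left)

theorem proposition1:
  fixes n :: nat
    and a b c \<mu> \<nu> \<kappa> :: real
    and y :: "real poly"
    and c\<^sub>n :: real
    and x :: "nat \<Rightarrow> real"
  assumes "n \<ge> 1"
    and "degree y = n"
    and "y = smult c\<^sub>n (\<Prod>i\<in>{1..n}. [:- x i, 1:])"
    and "c\<^sub>n \<noteq> 0"
    and "\<forall>t. (a * t\<^sup>2 + b * t + c) * poly (pderiv (pderiv y)) t
            + (\<mu> * t + \<nu>) * poly (pderiv y) t + \<kappa> * poly y t = 0"
    and "inj_on x {1..n}"
  shows "\<forall>k\<in>{1..n}.
    2 * (\<Sum>j\<in>{1..n} - {k}. (a * (x k)\<^sup>2 + b * x k + c) / (x k - x j)) + \<nu> + \<mu> * x k = 0"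
proof
  fix k assume k: "k \<in> {1..n}"
  let ?J = "{1..n} - {k}" and ?t = "x k"
  define q where "q = smult c\<^sub>n (\<Prod>i\<in>?J. [:- x i, 1:])"
  define S where "S = (\<Sum>j\<in>?J. 1 / (?t - x j))"
  \<comment> \<open>Distinctness of the zeros enters here: it keeps \<open>q\<close> nonzero at
    \<open>?t\<close> and the denominators in \<open>S\<close> nonzero.\<close>
  have ne: "?t \<noteq> x j" if "j \<in> ?J" for j
    using inj_onD[OF assms(6), of k j] k that by auto
  have y: "y = [:- ?t, 1:] * q"
    using prod.remove[of "{1..n}" k "\<lambda>i. [:- x i, 1:]"] k assms(3) by (simp add: q_def)
  have q0: "poly q ?t \<noteq> 0"
    using ne assms(4) by (auto simp: q_def poly_prod)
  have q': "poly (pderiv q) ?t = poly q ?t * S"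
    using poly_pderiv_prod_linear[of ?J ?t x] ne by (simp add: q_def S_def pderiv_smult)
  \<comment> \<open>Deleting \<open>mult_pCons_left\<close> keeps \<open>[:- ?t, 1:] * q\<close>
    factored, so the product rule applies and terms still carrying the linear factor vanish at
    \<open>?t\<close>.\<close>
  have y0: "poly y ?t = 0" and y1: "poly (pderiv y) ?t = poly q ?t"
    and y2: "poly (pderiv (pderiv y)) ?t = 2 * poly (pderiv q) ?t"
    by (simp_all add: y pderiv_mult pderiv_pCons pderiv_add del: mult_pCons_left)
  \<comment> \<open>The \<kappa> term drops out because \<open>?t\<close> is a zero of
    \<open>y\<close>; both remaining terms contain the factor \<open>poly q ?t\<close>.\<close>
  have "poly q ?t * (2 * ((a * ?t\<^sup>2 + b * ?t + c) * S) + \<nu> + \<mu> * ?t) = 0"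
    using assms(5)[rule_format, of ?t] unfolding y0 y1 y2 q' by (simp add: algebra_simps)
  then show "2 * (\<Sum>j\<in>?J. (a * ?t\<^sup>2 + b * ?t + c) / (?t - x j)) + \<nu> + \<mu> * ?t = 0"
    using q0 by (simp add: S_def sum_distrib_left)
qed

end
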